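(* Let $\Lambda$ be a Legendrian link. If $\widehat\lambda^+_{\mathrm{big}}(\Lambda)=0$, then $\widehat\lambda^+(\Lambda)=0$. Similarly, if $\widehat\lambda^-_{\mathrm{big}}(\Lambda)=0$, then $\widehat\lambda^-(\Lambda)=0$.
   Context: Grid diagrams. A grid diagram $\mathbb G$ of size $n$ is an $n\times n$ grid of unit squares in $[0,n]\times[0,n]$ with two sets of markings $\mathbb X=\{X_1,\dots,X_n\}$, $\mathbb O=\{O_1,\dots,O_n\}$ placed at centers of squares, such that every row and every column contains exactly one $X$ and exactly one $O$, and no square contains more than one marking. It specifies an oriented link $L(\mathbb G)\subset\mathbb R^3$: draw horizontal segments from the $O$'s to the $X$'s, vertical segments from the $X$'s to the $O$'s, with vertical segments passing over horizontal ones. Let $\ell$ be its number of components. It also specifies an oriented Legendrian link $\Lambda(\mathbb G)$ in $(\mathbb R^3,\xi_{\mathrm{std}})$, $\xi_{\mathrm{std}}=\ker(dz-y\,dx)$, given by its front projection (to the $xz$-plane): in the projection of $L(\mathbb G)$, smooth all northwest and southeast corners, turn northeast and southwest corners into cusps, rotate $45$ degrees clockwise, and flip all crossings. $\mathbb G$ represents $\Lambda$ if $\Lambda(\mathbb G)$ is Legendrian isotopic to $\Lambda$; every Legendrian link in $(\mathbb R^3,\xi_{\mathrm{std}})$ is represented by some grid diagram. Grid states and rectangles. Identify opposite sides of the grid to get a torus; the grid lines become horizontal circles $\boldsymbol\alpha=\{\alpha_1,\dots,\alpha_n\}$ and vertical circles $\boldsymbol\beta=\{\beta_1,\dots,\beta_n\}$.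 A grid state is an $n$-tuple $\mathbf x$ of points of the torus with exactly one point on each horizontal circle and one on each vertical circle; $S(\mathbb G)$ is the set of grid states. For $\mathbf x,\mathbf y\in S(\mathbb G)$, $\mathrm{Rect}(\mathbf x,\mathbf y)$ is empty unless $\mathbf x,\mathbf y$ agree in exactly $n-2$ points, in which case it is the set of rectangles $r$ embedded in the torus with $\partial r$ contained in the union of the horizontal and vertical circles, with vertices exactly $\mathbf x\triangle\mathbf y$, and with $\partial(\partial r\cap\boldsymbol\beta)=\mathbf x-\mathbf y$ in the induced orientation. $\mathrm{Rect}^\circ(\mathbf x,\mathbf y)$ is the subset of those $r$ that are empty, i.e. $\mathrm{Int}(r)\cap\mathbf x=\mathrm{Int}(r)\cap\mathbf y=\emptyset$. $O_i(r)\in\{0,1\}$ is $1$ iff $O_i\in r$. Complexes. $\mathbb F=\mathbb Z/2$. $GC^-(\mathbb G)$ is the free $\mathbb F[V_1,\dots,V_n]$-module on $S(\mathbb G)$ with differential $$\mathbf x\mapsto\sum_{\mathbf y}\ \sum_{r\in\mathrm{Rect}^\circ(\mathbf x,\mathbf y),\,r\cap\mathbb X=\emptyset}V_1^{O_1(r)}\cdots V_n^{O_n(r)}\,\mathbf y,$$ and $GC^-_{\mathrm{big}}(\mathbb G)$ is the free $\mathbb F[V_1,\dots,V_n,v]$-module on $S(\mathbb G)$ with differential $$\mathbf x\mapsto\sum_{\mathbf y}\ \sum_{r\in\mathrm{Rect}(\mathbf x,\mathbf y),\,r\cap\mathbb X=\emptyset}V_1^{O_1(r)}\cdots V_n^{O_n(r)}\,v^{\#(\mathrm{Int}(r)\cap\mathbf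 x)}\,\mathbf y.$$ Fix, for each $i=1,\dots,\ell$, an index $k_i$ such that $O_{k_i}$ lies on the $i$-th link component. $\widehat{GH}(\mathbb G)$ and $\widehat{GH}_{\mathrm{big}}(\mathbb G)$ are the homologies of $GC^-(\mathbb G)/(V_{k_1},\dots,V_{k_\ell})$ and $GC^-_{\mathrm{big}}(\mathbb G)/(V_{k_1},\dots,V_{k_\ell})$, respectively. Canonical classes. $\mathbf x^+(\mathbb G)$ (resp. $\mathbf x^-(\mathbb G)$) is the grid state consisting of the northeast (resp. southwest) corners of the squares containing $X$ markings; these are cycles in each of the complexes $GC^-(\mathbb G)$, $GC^-_{\mathrm{big}}(\mathbb G)$, $GC^-(\mathbb G)/(V_{k_1},\dots,V_{k_\ell})$ and $GC^-_{\mathrm{big}}(\mathbb G)/(V_{k_1},\dots,V_{k_\ell})$. $\widehat\lambda^\pm(\Lambda)$ and $\widehat\lambda^\pm_{\mathrm{big}}(\Lambda)$ denote the homology classes of $\mathbf x^\pm(\mathbb G)$ in $\widehat{GH}(\mathbb G)$ and $\widehat{GH}_{\mathrm{big}}(\mathbb G)$, respectively, for any grid diagram $\mathbb G$ representing $\Lambda$; they are well defined up to isomorphism, and in particular their vanishing does not depend on the choice of $\mathbb G$. *)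

theory Defs
  imports
    "HOL-Analysis.Analysis"
    "HOL-Algebra.AbelCoset"
    "HOL-Algebra.Module"
    "HOL-Library.Poly_Mapping"
    "HOL-Library.Z2"
begin

section \<open>Grid diagrams\<close>

text \<open>
  The square \<open>[a,a+1] \<times> [b,b+1]\<close> is encoded by its lower left corner \<open>(a, b)\<close>, first coordinate
  horizontal. The markings are \<open>X\<^sub>1, \<dots>, X\<^sub>n\<close> and \<open>O\<^sub>1, \<dots>, O\<^sub>n\<close>; the values of the two functions
  at other indices are irrelevant.
\<close>

record grid =
  gsize :: nat
  Xmark :: "nat \<Rightarrow> nat \<times> nat"
  Omark :: "nat \<Rightarrow> nat \<times> nat"

definition one_per_row_and_column :: "nat \<Rightarrow> (nat \<Rightarrow> nat \<times> nat) \<Rightarrow> bool" where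
  "one_per_row_and_column n M \<longleftrightarrow>
     (\<forall>i\<in>{1..n}. M i \<in> {..<n} \<times> {..<n}) \<and>
     (\<forall>c<n. \<exists>!i. i \<in> {1..n} \<and> fst (M i) = c) \<and>
     (\<forall>r<n. \<exists>!i. i \<in> {1..n} \<and> snd (M i) = r)"

definition grid_diagram :: "grid \<Rightarrow> bool" where
  "grid_diagram G \<longleftrightarrow>
     0 < gsize G \<and>
     one_per_row_and_column (gsize G) (Xmark G) \<and>
     one_per_row_and_column (gsize G) (Omark G) \<and>
     (\<forall>i\<in>{1..gsize G}. \<forall>j\<in>{1..gsize G}. Xmark G i \<noteq> Omark G j)"

text \<open>
  Travelling along the link \<open>L(G)\<close>: from \<open>O\<^sub>i\<close> horizontally to the \<open>X\<close> in the same row, then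
  vertically to the \<open>O\<close> in the column of that \<open>X\<close>. A link component is identified with the set
  of indices of the \<open>O\<close> markings on it.
\<close>

definition X_in_row_of :: "grid \<Rightarrow> nat \<Rightarrow> nat" where
  "X_in_row_of G i = (THE m. m \<in> {1..gsize G} \<and> snd (Xmark G m) = snd (Omark G i))"

definition O_in_column_of :: "grid \<Rightarrow> nat \<Rightarrow> nat" where
  "O_in_column_of G m = (THE j. j \<in> {1..gsize G} \<and> fst (Omark G j) = fst (Xmark G m))"

definition next_O :: "grid \<Rightarrow> nat \<Rightarrow> nat" where
  "next_O G i = O_in_column_of G (X_in_row_of G i)"

definition link_component :: "grid \<Rightarrow> nat \<Rightarrow> nat set" where
  "link_component G i = {(next_O G ^^ m) i |m. True}"

definition link_components :: "grid \<Rightarrow> nat set set" where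
  "link_components G = link_component G ` {1..gsize G}"

definition component_choice :: "grid \<Rightarrow> (nat set \<Rightarrow> nat) \<Rightarrow> bool" where
  "component_choice G k \<longleftrightarrow> (\<forall>C\<in>link_components G. k C \<in> C)"


section \<open>Legendrian links in the standard contact space\<close>

type_synonym R3 = "real \<times> real \<times> real"

primrec times_cont_diff :: "nat \<Rightarrow> ('a::real_normed_vector \<Rightarrow> 'b::real_normed_vector) \<Rightarrow> bool" where
  "times_cont_diff 0 f \<longleftrightarrow> continuous_on UNIV f"
| "times_cont_diff (Suc m) f \<longleftrightarrow>
     (\<forall>x. f differentiable (at x)) \<and>
     (\<forall>v. times_cont_diff m (\<lambda>x. frechet_derivative f (at x) v))"

definition smooth :: "('a::real_normed_vector \<Rightarrow> 'b::real_normed_vector) \<Rightarrow> bool" where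
  "smooth f \<longleftrightarrow> (\<forall>m. times_cont_diff m f)"

definition xi_std :: "R3 \<Rightarrow> R3 set" where
  "xi_std = (\<lambda>(x, y, z). {(dx, dy, dz). dz - y * dx = 0})"

definition legendrian_knot :: "(real \<Rightarrow> R3) \<Rightarrow> bool" where
  "legendrian_knot \<gamma> \<longleftrightarrow>
     smooth \<gamma> \<and>
     (\<forall>t. vector_derivative \<gamma> (at t) \<noteq> 0) \<and>
     (\<forall>s t. \<gamma> s = \<gamma> t \<longleftrightarrow> s - t \<in> \<int>) \<and>
     (\<forall>t. vector_derivative \<gamma> (at t) \<in> xi_std (\<gamma> t))"

text \<open>
  An oriented link is a finite set of disjoint parametrized components. Orientation-preserving
  reparametrizations of the components are absorbed by Legendrian isotopy: they are isotopic to
  the identity by convex interpolation.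
\<close>

definition legendrian_link :: "(real \<Rightarrow> R3) set \<Rightarrow> bool" where
  "legendrian_link \<Lambda> \<longleftrightarrow>
     finite \<Lambda> \<and> (\<forall>\<gamma>\<in>\<Lambda>. legendrian_knot \<gamma>) \<and>
     (\<forall>\<gamma>\<in>\<Lambda>. \<forall>\<delta>\<in>\<Lambda>. \<gamma> \<noteq> \<delta> \<longrightarrow> range \<gamma> \<inter> range \<delta> = {})"

text \<open>The injectivity condition keeps two components from merging into one during the isotopy.\<close>

definition legendrian_isotopic :: "(real \<Rightarrow> R3) set \<Rightarrow> (real \<Rightarrow> R3) set \<Rightarrow> bool" where
  "legendrian_isotopic \<Lambda>\<^sub>0 \<Lambda>\<^sub>1 \<longleftrightarrow>
     (\<exists>H :: (real \<Rightarrow> R3) \<Rightarrow> real \<times> real \<Rightarrow> R3.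
        (\<forall>\<gamma>\<in>\<Lambda>\<^sub>0. smooth (H \<gamma>) \<and> (\<forall>t. H \<gamma> (0, t) = \<gamma> t)) \<and>
        (\<forall>s\<in>{0..1}. inj_on (\<lambda>\<gamma> t. H \<gamma> (s, t)) \<Lambda>\<^sub>0 \<and>
                      legendrian_link ((\<lambda>\<gamma> t. H \<gamma> (s, t)) ` \<Lambda>\<^sub>0)) \<and>
        (\<lambda>\<gamma> t. H \<gamma> (1, t)) ` \<Lambda>\<^sub>0 = \<Lambda>\<^sub>1)"


section \<open>The Legendrian link of a grid diagram\<close>

definition front :: "(real \<Rightarrow> R3) \<Rightarrow> real \<Rightarrow> real \<times> real" where
  "front \<gamma> t = (fst (\<gamma> t), snd (snd (\<gamma> t)))"

definition rot45cw :: "real \<times> real \<Rightarrow> real \<times> real" where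
  "rot45cw = (\<lambda>(u, v). ((u + v) / sqrt 2, (v - u) / sqrt 2))"

definition square_centre :: "nat \<times> nat \<Rightarrow> real \<times> real" where
  "square_centre = (\<lambda>(a, b). (real a + 1 / 2, real b + 1 / 2))"

text \<open>The markings met successively when following \<open>L(G)\<close> from \<open>O\<^sub>i\<close>.\<close>

definition corner :: "grid \<Rightarrow> nat \<Rightarrow> nat \<Rightarrow> real \<times> real" where
  "corner G i j = square_centre
     (let m = (next_O G ^^ (j div 2)) i
      in if even j then Omark G m else Xmark G (X_in_row_of G m))"

text \<open>The middle point \<open>q\<close> is a northeast (southwest) corner of the path \<open>p, q, r\<close>.\<close>

definition NE_corner :: "real \<times> real \<Rightarrow> real \<times> real \<Rightarrow> real \<times> real \<Rightarrow> bool" where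
  "NE_corner p q r \<longleftrightarrow> fst p \<le> fst q \<and> snd p \<le> snd q \<and> fst r \<le> fst q \<and> snd r \<le> snd q"

definition SW_corner :: "real \<times> real \<Rightarrow> real \<times> real \<Rightarrow> real \<times> real \<Rightarrow> bool" where
  "SW_corner p q r \<longleftrightarrow> fst q \<le> fst p \<and> snd q \<le> snd p \<and> fst q \<le> fst r \<and> snd q \<le> snd r"

text \<open>
  The front of \<open>\<gamma>\<close> is the rotated component \<open>C\<close> of \<open>L(G)\<close>, with its NE and SW corners turned into
  semicubical cusps and its other corners smoothed. The curve is within distance \<open>1/4\<close> of the
  \<open>j\<close>-th corner for times in \<open>[a j, b j]\<close>, and runs along the \<open>j\<close>-th edge for times in
  \<open>[b j, a (j + 1)]\<close>; one period of \<open>\<gamma>\<close> passes \<open>2 * card C\<close> corners. Distinct corners, crossings and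
  non-adjacent edges have distance at least \<open>1\<close> from each other resp. from a given corner, so the
  roundings do not interfere, and injectivity excludes crossings created by the rounding itself.
  Crossings need no separate mention: as \<open>y = dz/dx\<close> on a Legendrian curve and the \<open>y\<close>-axis points
  away from the viewer of the \<open>xz\<close>-plane, the strand of smaller slope is in front, i.e. the
  rotated horizontal segment (slope \<open>-1\<close>) passes over the rotated vertical one (slope \<open>1\<close>).
  This is \<open>L(G)\<close> with all crossings flipped.
\<close>

definition front_of_component :: "grid \<Rightarrow> nat set \<Rightarrow> (real \<Rightarrow> R3) \<Rightarrow> bool" where
  "front_of_component G C \<gamma> \<longleftrightarrow>
     (\<exists>i\<in>C. \<exists>a b :: nat \<Rightarrow> real.
        let q = corner G i; N = 2 * card C; x = (\<lambda>t. fst (\<gamma> t)) in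
        (\<forall>j. a j < b j \<and> b j < a (Suc j) \<and> a (j + N) = a j + 1 \<and> b (j + N) = b j + 1) \<and>
        (\<forall>j. (\<forall>t\<in>{a j..b j}. dist (front \<gamma> t) (rot45cw (q j)) \<le> 1 / 4) \<and>
             (\<forall>t\<in>{b j..a (Suc j)}.
                front \<gamma> t \<in> closed_segment (rot45cw (q j)) (rot45cw (q (Suc j)))) \<and>
             inj_on (front \<gamma>) {b j..a (Suc (Suc j))} \<and>
             (let Z = {t \<in> {b j..a (Suc (Suc j))}. deriv x t = 0};
                  p = q j; p' = q (Suc j); p'' = q (Suc (Suc j)) in
              if NE_corner p p' p'' \<or> SW_corner p p' p''
              then \<exists>t\<in>{a (Suc j)<..<b (Suc j)}. Z = {t} \<and> deriv (deriv x) t \<noteq> 0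
              else Z = {})))"

text \<open>The preceding conditions determine the link up to Legendrian isotopy; this is \<open>\<Lambda>(G)\<close>.\<close>

definition is_link_of_grid :: "grid \<Rightarrow> (real \<Rightarrow> R3) set \<Rightarrow> bool" where
  "is_link_of_grid G \<Lambda> \<longleftrightarrow>
     legendrian_link \<Lambda> \<and>
     (\<exists>f. bij_betw f \<Lambda> (link_components G) \<and> (\<forall>\<gamma>\<in>\<Lambda>. front_of_component G (f \<gamma>) \<gamma>))"

definition represents :: "grid \<Rightarrow> (real \<Rightarrow> R3) set \<Rightarrow> bool" where
  "represents G \<Lambda> \<longleftrightarrow> (\<exists>\<Lambda>'. is_link_of_grid G \<Lambda>' \<and> legendrian_isotopic \<Lambda>' \<Lambda>)"


section \<open>Grid states and rectangles\<close>

text \<open>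
  The point \<open>(a, b)\<close> with \<open>a, b < n\<close> is the intersection of the \<open>a\<close>-th vertical and the \<open>b\<close>-th
  horizontal circle of the torus.
\<close>

type_synonym state = "(nat \<times> nat) set"

definition grid_states :: "grid \<Rightarrow> state set" where
  "grid_states G =
     {x. x \<subseteq> {..<gsize G} \<times> {..<gsize G} \<and>
         (\<forall>a<gsize G. \<exists>!b. (a, b) \<in> x) \<and> (\<forall>b<gsize G. \<exists>!a. (a, b) \<in> x)}"

text \<open>
  A rectangle embedded in the torus with four distinct vertices on the grid lines is given by its
  lower left vertex and its width and height, both between \<open>1\<close> and \<open>n - 1\<close>.
\<close>

record rectangle =
  rleft :: nat
  rbottom :: nat
  rwidth :: nat
  rheight :: nat

definition rectangles :: "nat \<Rightarrow> rectangle set" where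
  "rectangles n = {r. rleft r < n \<and> rbottom r < n \<and> rwidth r \<in> {1..<n} \<and> rheight r \<in> {1..<n}}"

definition rect_pt :: "nat \<Rightarrow> rectangle \<Rightarrow> nat \<Rightarrow> nat \<Rightarrow> nat \<times> nat" where
  "rect_pt n r c d = ((rleft r + c) mod n, (rbottom r + d) mod n)"

definition rect_squares :: "nat \<Rightarrow> rectangle \<Rightarrow> (nat \<times> nat) set" where
  "rect_squares n r = {rect_pt n r c d |c d. c < rwidth r \<and> d < rheight r}"

definition rect_interior :: "nat \<Rightarrow> rectangle \<Rightarrow> (nat \<times> nat) set" where
  "rect_interior n r = {rect_pt n r c d |c d. 0 < c \<and> c < rwidth r \<and> 0 < d \<and> d < rheight r}"

text \<open>
  In the boundary orientation the right edge points up and the left edge points down, so the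
  boundary of the vertical part of \<open>\<partial>r\<close> is \<open>(NE - SE) + (SW - NW)\<close>. This equals \<open>x - y\<close> exactly
  when \<open>x\<close> contributes the SW and NE vertices and \<open>y\<close> the SE and NW ones.
\<close>

definition Rect :: "grid \<Rightarrow> state \<Rightarrow> state \<Rightarrow> rectangle set" where
  "Rect G x y =
     {r \<in> rectangles (gsize G).
        card (x \<inter> y) + 2 = gsize G \<and>
        x - y = {rect_pt (gsize G) r 0 0, rect_pt (gsize G) r (rwidth r) (rheight r)} \<and>
        y - x = {rect_pt (gsize G) r (rwidth r) 0, rect_pt (gsize G) r 0 (rheight r)}}"

definition empty_Rect :: "grid \<Rightarrow> state \<Rightarrow> state \<Rightarrow> rectangle set" where
  "empty_Rect G x y =
     {r \<in> Rect G x y. rect_interior (gsize G) r \<inter> x = {} \<and> rect_interior (gsize G) r \<inter> y = {}}"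

definition avoids_X :: "grid \<Rightarrow> rectangle \<Rightarrow> bool" where
  "avoids_X G r \<longleftrightarrow> rect_squares (gsize G) r \<inter> Xmark G ` {1..gsize G} = {}"

definition O_count :: "grid \<Rightarrow> nat \<Rightarrow> rectangle \<Rightarrow> nat" where
  "O_count G i r = (if Omark G i \<in> rect_squares (gsize G) r then 1 else 0)"


section \<open>Grid complexes\<close>

datatype var = V nat | v

text \<open>Polynomials over the field with two elements; a monomial maps each variable to its exponent.\<close>

type_synonym gpoly = "(var \<Rightarrow>\<^sub>0 nat) \<Rightarrow>\<^sub>0 bit"

definition pvar :: "var \<Rightarrow> gpoly" where
  "pvar w = Poly_Mapping.single (Poly_Mapping.single w 1) 1"

definition polys_in :: "var set \<Rightarrow> gpoly set" where
  "polys_in W = {p. \<forall>m\<in>Poly_Mapping.keys p. Poly_Mapping.keys m \<subseteq> W}"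

text \<open>
  The free module with basis \<open>S\<close> (finite in all uses) over the polynomial ring in the variables
  \<open>W\<close>. The fields \<open>mult\<close> and \<open>one\<close> of the library's module record play no role.
\<close>

definition free_module :: "var set \<Rightarrow> state set \<Rightarrow> (gpoly, state \<Rightarrow> gpoly) module" where
  "free_module W S =
     \<lparr>carrier = {c. (\<forall>x\<in>S. c x \<in> polys_in W) \<and> (\<forall>x. x \<notin> S \<longrightarrow> c x = 0)},
      mult = undefined, one = undefined,
      zero = (\<lambda>x. 0), add = (\<lambda>c c' x. c x + c' x),
      smult = (\<lambda>p c x. p * c x)\<rparr>"

definition generator :: "state \<Rightarrow> state \<Rightarrow> gpoly" where
  "generator x = (\<lambda>y. if y = x then 1 else 0)"

definition V_weight :: "grid \<Rightarrow> rectangle \<Rightarrow> gpoly" where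
  "V_weight G r = (\<Prod>i\<in>{1..gsize G}. pvar (V i) ^ O_count G i r)"

definition GC_minus :: "grid \<Rightarrow> (gpoly, state \<Rightarrow> gpoly) module" where
  "GC_minus G = free_module (V ` {1..gsize G}) (grid_states G)"

definition GC_big :: "grid \<Rightarrow> (gpoly, state \<Rightarrow> gpoly) module" where
  "GC_big G = free_module (insert v (V ` {1..gsize G})) (grid_states G)"

definition d_minus :: "grid \<Rightarrow> (state \<Rightarrow> gpoly) \<Rightarrow> (state \<Rightarrow> gpoly)" where
  "d_minus G c = (\<lambda>y. if y \<in> grid_states G
     then \<Sum>x\<in>grid_states G. c x * (\<Sum>r | r \<in> empty_Rect G x y \<and> avoids_X G r. V_weight G r)
     else 0)"

definition d_big :: "grid \<Rightarrow> (state \<Rightarrow> gpoly) \<Rightarrow> (state \<Rightarrow> gpoly)" where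
  "d_big G c = (\<lambda>y. if y \<in> grid_states G
     then \<Sum>x\<in>grid_states G. c x * (\<Sum>r | r \<in> Rect G x y \<and> avoids_X G r.
            V_weight G r * pvar v ^ card (rect_interior (gsize G) r \<inter> x))
     else 0)"

text \<open>The submodule \<open>(V\<^bsub>k\<^sub>1\<^esub>, \<dots>, V\<^bsub>k\<^sub>l\<^esub>) M\<close> of \<open>M\<close>, where \<open>K = {k\<^sub>1, \<dots>, k\<^sub>l}\<close>.\<close>

definition V_submodule ::
    "(gpoly, state \<Rightarrow> gpoly) module \<Rightarrow> nat set \<Rightarrow> (state \<Rightarrow> gpoly) set" where
  "V_submodule M K = {(\<lambda>x. \<Sum>j\<in>K. (pvar (V j) \<odot>\<^bsub>M\<^esub> c j) x) |c. \<forall>j\<in>K. c j \<in> carrier M}"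

text \<open>
  The differential induced by \<open>d\<close> on the quotient of \<open>M\<close> by \<open>I\<close>; the union is that of the cosets
  of \<open>d c\<close> for all representatives \<open>c\<close>, which coincide when \<open>d\<close> maps \<open>I\<close> to itself.
\<close>

definition induced_d :: "(gpoly, state \<Rightarrow> gpoly) module \<Rightarrow> (state \<Rightarrow> gpoly) set \<Rightarrow>
    ((state \<Rightarrow> gpoly) \<Rightarrow> (state \<Rightarrow> gpoly)) \<Rightarrow> (state \<Rightarrow> gpoly) set \<Rightarrow> (state \<Rightarrow> gpoly) set" where
  "induced_d M I d U = (\<Union>c\<in>U. I +>\<^bsub>M\<^esub> d c)"

text \<open>
  Homology of a differential \<open>d\<close> on a group \<open>Q\<close>, and the class of a cycle. Only the group
  structure is recorded, which is all that the vanishing of a class refers to.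
\<close>

definition homology :: "'a monoid \<Rightarrow> ('a \<Rightarrow> 'a) \<Rightarrow> 'a set monoid" where
  "homology Q d = (Q\<lparr>carrier := kernel Q Q d\<rparr>) Mod (d ` carrier Q)"

definition homology_class :: "'a monoid \<Rightarrow> ('a \<Rightarrow> 'a) \<Rightarrow> 'a \<Rightarrow> 'a set" where
  "homology_class Q d c = (d ` carrier Q) #>\<^bsub>Q\<^esub> c"

definition basepoints :: "grid \<Rightarrow> (nat set \<Rightarrow> nat) \<Rightarrow> nat set" where
  "basepoints G k = k ` link_components G"

definition GC_hat :: "grid \<Rightarrow> (nat set \<Rightarrow> nat) \<Rightarrow> (state \<Rightarrow> gpoly) set monoid" where
  "GC_hat G k = GC_minus G A_Mod V_submodule (GC_minus G) (basepoints G k)"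

definition d_hat :: "grid \<Rightarrow> (nat set \<Rightarrow> nat) \<Rightarrow> (state \<Rightarrow> gpoly) set \<Rightarrow> (state \<Rightarrow> gpoly) set" where
  "d_hat G k = induced_d (GC_minus G) (V_submodule (GC_minus G) (basepoints G k)) (d_minus G)"

definition GH_hat :: "grid \<Rightarrow> (nat set \<Rightarrow> nat) \<Rightarrow> (state \<Rightarrow> gpoly) set set monoid" where
  "GH_hat G k = homology (GC_hat G k) (d_hat G k)"

definition GC_hat_big :: "grid \<Rightarrow> (nat set \<Rightarrow> nat) \<Rightarrow> (state \<Rightarrow> gpoly) set monoid" where
  "GC_hat_big G k = GC_big G A_Mod V_submodule (GC_big G) (basepoints G k)"

definition d_hat_big ::
    "grid \<Rightarrow> (nat set \<Rightarrow> nat) \<Rightarrow> (state \<Rightarrow> gpoly) set \<Rightarrow> (state \<Rightarrow> gpoly) set" where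
  "d_hat_big G k = induced_d (GC_big G) (V_submodule (GC_big G) (basepoints G k)) (d_big G)"

definition GH_hat_big :: "grid \<Rightarrow> (nat set \<Rightarrow> nat) \<Rightarrow> (state \<Rightarrow> gpoly) set set monoid" where
  "GH_hat_big G k = homology (GC_hat_big G k) (d_hat_big G k)"


section \<open>Canonical classes\<close>

definition x_plus :: "grid \<Rightarrow> state" where
  "x_plus G = (\<lambda>(a, b). (Suc a mod gsize G, Suc b mod gsize G)) ` Xmark G ` {1..gsize G}"

definition x_minus :: "grid \<Rightarrow> state" where
  "x_minus G = Xmark G ` {1..gsize G}"

definition hat_class :: "grid \<Rightarrow> (nat set \<Rightarrow> nat) \<Rightarrow> state \<Rightarrow> (state \<Rightarrow> gpoly) set set" where
  "hat_class G k x = homology_class (GC_hat G k) (d_hat G k)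
     (V_submodule (GC_minus G) (basepoints G k) +>\<^bsub>GC_minus G\<^esub> generator x)"

definition hat_big_class :: "grid \<Rightarrow> (nat set \<Rightarrow> nat) \<Rightarrow> state \<Rightarrow> (state \<Rightarrow> gpoly) set set" where
  "hat_big_class G k x = homology_class (GC_hat_big G k) (d_hat_big G k)
     (V_submodule (GC_big G) (basepoints G k) +>\<^bsub>GC_big G\<^esub> generator x)"

definition lambda_hat_plus where "lambda_hat_plus G k = hat_class G k (x_plus G)"
definition lambda_hat_minus where "lambda_hat_minus G k = hat_class G k (x_minus G)"
definition lambda_hat_big_plus where "lambda_hat_big_plus G k = hat_big_class G k (x_plus G)"
definition lambda_hat_big_minus where "lambda_hat_big_minus G k = hat_big_class G k (x_minus G)"

end

theory Submission
  imports Defs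
begin

text \<open>
  An empty rectangle is one without generators in its interior, so setting \<open>v = 0\<close> turns the
  differential of the big complex into that of \<open>GC\<^sup>-\<close>. This substitution is compatible with the
  quotients by \<open>V\<^bsub>k\<^sub>1\<^esub>, \<dots>, V\<^bsub>k\<^sub>l\<^esub>\<close> and fixes every grid state; hence a
  null-homology of a grid state in the big complex is mapped to one in the small complex.
\<close>

section \<open>Polynomials and the substitution \<open>v = 0\<close>\<close>

lemma polys_in_zero [simp]: "0 \<in> polys_in W"
  by (simp add: polys_in_def)

lemma polys_in_one [simp]: "1 \<in> polys_in W"
  by (simp add: polys_in_def)

lemma polys_in_add: "p \<in> polys_in W \<Longrightarrow> q \<in> polys_in W \<Longrightarrow> p + q \<in> polys_in W"
  using keys_add[of p q] by (auto simp: polys_in_def)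

lemma polys_in_uminus: "p \<in> polys_in W \<Longrightarrow> - p \<in> polys_in W"
  by (simp add: polys_in_def in_keys_iff)

lemma polys_in_mult:
  assumes "p \<in> polys_in W" "q \<in> polys_in W"
  shows "p * q \<in> polys_in W"
proof -
  have "Poly_Mapping.keys m \<subseteq> W" if m: "m \<in> Poly_Mapping.keys (p * q)" for m
  proof -
    obtain a b where "m = a + b" "a \<in> Poly_Mapping.keys p" "b \<in> Poly_Mapping.keys q"
      using keys_mult[of p q] m by blast
    with assms show ?thesis
      using keys_add[of a b] unfolding polys_in_def by blast
  qed
  then show ?thesis by (simp add: polys_in_def)
qed

lemma polys_in_sum: "(\<And>a. a \<in> A \<Longrightarrow> f a \<in> polys_in W) \<Longrightarrow> sum f A \<in> polys_in W"
  by (induction A rule: infinite_finite_induct) (auto intro: polys_in_add)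

lemma polys_in_prod: "(\<And>a. a \<in> A \<Longrightarrow> f a \<in> polys_in W) \<Longrightarrow> prod f A \<in> polys_in W"
  by (induction A rule: infinite_finite_induct) (auto intro: polys_in_mult)

lemma polys_in_power: "p \<in> polys_in W \<Longrightarrow> p ^ k \<in> polys_in W"
  by (induction k) (auto intro: polys_in_mult)

lemma polys_in_pvar: "w \<in> W \<Longrightarrow> pvar w \<in> polys_in W"
  by (simp add: polys_in_def pvar_def)

lemma polys_in_mono: "W \<subseteq> W' \<Longrightarrow> polys_in W \<subseteq> polys_in W'"
  by (auto simp: polys_in_def)

text \<open>Setting \<open>v = 0\<close> deletes exactly the monomials that contain
  \<open>v\<close>. This coefficientwise form makes additivity immediate and leaves multiplicativity
  to be proved.\<close>

lift_definition set_v_zero :: "gpoly \<Rightarrow> gpoly" is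
  "\<lambda>p m. if v \<in> Poly_Mapping.keys m then 0 else p m"
  by (erule rev_finite_subset) auto

lemma lookup_set_v_zero:
  "Poly_Mapping.lookup (set_v_zero p) m =
     (if v \<in> Poly_Mapping.keys m then 0 else Poly_Mapping.lookup p m)"
  by transfer simp

lemma set_v_zero_zero [simp]: "set_v_zero 0 = 0"
  by (rule poly_mapping_eqI) (simp add: lookup_set_v_zero)

lemma set_v_zero_add: "set_v_zero (p + q) = set_v_zero p + set_v_zero q"
  by (rule poly_mapping_eqI) (simp add: lookup_set_v_zero lookup_add)

lemma set_v_zero_sum: "set_v_zero (sum f A) = (\<Sum>a\<in>A. set_v_zero (f a))"
  using sum_comp_morphism[of set_v_zero f A] by (simp add: set_v_zero_add comp_def)

lemma set_v_zero_id:
  assumes "p \<in> polys_in W" "v \<notin> W"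
  shows "set_v_zero p = p"
proof (rule poly_mapping_eqI)
  fix m
  show "Poly_Mapping.lookup (set_v_zero p) m = Poly_Mapping.lookup p m"
    using assms by (cases "m \<in> Poly_Mapping.keys p")
      (auto simp: lookup_set_v_zero polys_in_def not_in_keys_iff_lookup_eq_zero)
qed

lemma set_v_zero_in:
  assumes "p \<in> polys_in (insert v W)"
  shows "set_v_zero p \<in> polys_in W"
proof -
  have "Poly_Mapping.keys m \<subseteq> W" if "m \<in> Poly_Mapping.keys (set_v_zero p)" for m
  proof -
    have "v \<notin> Poly_Mapping.keys m" "m \<in> Poly_Mapping.keys p"
      using that by (auto simp: in_keys_iff lookup_set_v_zero split: if_splits)
    with assms show ?thesis by (auto simp: polys_in_def)
  qed
  then show ?thesis by (simp add: polys_in_def)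
qed

text \<open>The kernel consists of the polynomials all of whose monomials contain \<open>v\<close>.
  A monomial of the product has a monomial of \<open>p\<close> as a factor and so contains
  \<open>v\<close> too: the kernel is an ideal.\<close>

lemma set_v_zero_kernel_mult:
  assumes "set_v_zero p = 0"
  shows "set_v_zero (p * q) = 0"
proof (rule poly_mapping_eqI)
  fix m
  have "v \<in> Poly_Mapping.keys m" if m: "m \<in> Poly_Mapping.keys (p * q)"
  proof -
    obtain a b where ab: "m = a + b" "a \<in> Poly_Mapping.keys p"
      using keys_mult[of p q] m by blast
    have "Poly_Mapping.lookup (set_v_zero p) a = 0" using assms by simp
    with ab(2) have "v \<in> Poly_Mapping.keys a"
      by (simp add: lookup_set_v_zero in_keys_iff split: if_splits)
    \<comment> \<open>Exponents are natural numbers, so adding \<open>b\<close> cannot cancel the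
      \<open>v\<close> in \<open>a\<close>.\<close>
    with ab(1) show ?thesis by (simp add: in_keys_iff lookup_add)
  qed
  then show "Poly_Mapping.lookup (set_v_zero (p * q)) m = Poly_Mapping.lookup 0 m"
    by (cases "m \<in> Poly_Mapping.keys (p * q)")
      (simp_all add: lookup_set_v_zero not_in_keys_iff_lookup_eq_zero)
qed

text \<open>Each factor is split into its \<open>v\<close>-free part and a remainder in the kernel.
  All terms with a remainder lie in the kernel ideal; the product of the \<open>v\<close>-free parts
  is \<open>v\<close>-free, hence fixed.\<close>

lemma set_v_zero_mult: "set_v_zero (p * q) = set_v_zero p * set_v_zero q"
proof -
  have diff: "set_v_zero (r - set_v_zero r) = 0" for r
    by (rule poly_mapping_eqI) (simp add: lookup_set_v_zero lookup_minus)
  \<comment> \<open>With \<open>W = UNIV - {v}\<close>, the set \<open>insert v W\<close> contains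
    all variables, so every polynomial qualifies.\<close>
  have in_rest: "set_v_zero r \<in> polys_in (UNIV - {v})" for r
    by (rule set_v_zero_in) (simp add: polys_in_def)
  have "p * q = set_v_zero p * set_v_zero q +
      ((p - set_v_zero p) * q + (q - set_v_zero q) * set_v_zero p)"
    by (simp add: algebra_simps)
  then have "set_v_zero (p * q) = set_v_zero (set_v_zero p * set_v_zero q)"
    by (simp add: set_v_zero_add set_v_zero_kernel_mult[OF diff])
  also have "\<dots> = set_v_zero p * set_v_zero q"
    by (rule set_v_zero_id[OF polys_in_mult[OF in_rest in_rest]]) simp
  finally show ?thesis .
qed

lemma set_v_zero_one [simp]: "set_v_zero 1 = 1"
  by (rule set_v_zero_id[of _ "{}"]) auto

lemma set_v_zero_power: "set_v_zero (p ^ k) = set_v_zero p ^ k"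
  by (induction k) (simp_all add: set_v_zero_mult)

lemma set_v_zero_v [simp]: "set_v_zero (pvar v) = 0"
  by (rule poly_mapping_eqI) (auto simp: lookup_set_v_zero pvar_def lookup_single when_def)

section \<open>Differentials on quotients of free modules\<close>

lemma free_module_simps [simp]:
  "c \<in> carrier (free_module W S) \<longleftrightarrow> (\<forall>x\<in>S. c x \<in> polys_in W) \<and> (\<forall>x. x \<notin> S \<longrightarrow> c x = 0)"
  "\<zero>\<^bsub>free_module W S\<^esub> = (\<lambda>x. 0)"
  "c \<oplus>\<^bsub>free_module W S\<^esub> c' = (\<lambda>x. c x + c' x)"
  "p \<odot>\<^bsub>free_module W S\<^esub> c = (\<lambda>x. p * c x)"
  by (simp_all add: free_module_def)

lemma abelian_group_free_module: "abelian_group (free_module W S)"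
proof (rule abelian_groupI)
  fix c assume c: "c \<in> carrier (free_module W S)"
  show "\<exists>c'\<in>carrier (free_module W S). c' \<oplus>\<^bsub>free_module W S\<^esub> c = \<zero>\<^bsub>free_module W S\<^esub>"
    by (rule bexI[of _ "\<lambda>x. - c x"]) (use c in \<open>auto intro: polys_in_uminus\<close>)
qed (auto intro: polys_in_add simp: fun_eq_iff algebra_simps)

lemma free_module_uminus:
  assumes c: "c \<in> carrier (free_module W S)"
  shows "\<ominus>\<^bsub>free_module W S\<^esub> c = (\<lambda>x. - c x)"
proof -
  interpret abelian_group "free_module W S" by (rule abelian_group_free_module)
  show ?thesis
    by (rule minus_equality) (use c in \<open>auto intro: polys_in_uminus\<close>)
qed

lemma additive_subgroup_V_submodule:
  assumes K: "V ` K \<subseteq> W"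
  shows "additive_subgroup (V_submodule (free_module W S) K) (free_module W S)"
proof -
  let ?M = "free_module W S"
  interpret M: abelian_group ?M by (rule abelian_group_free_module)
  have sub: "V_submodule ?M K \<subseteq> carrier ?M"
    using K by (auto simp: V_submodule_def image_subset_iff
        intro!: polys_in_sum polys_in_mult polys_in_pvar)
  have "subgroup (V_submodule ?M K) (add_monoid ?M)"
  proof (rule M.add.subgroupI)
    show "V_submodule ?M K \<subseteq> carrier ?M" by (rule sub)
    have "(\<lambda>x. \<Sum>j\<in>K. (pvar (V j) \<odot>\<^bsub>?M\<^esub> (\<lambda>x. 0)) x) \<in> V_submodule ?M K"
      unfolding V_submodule_def by (rule CollectI, rule exI[of _ "\<lambda>j x. 0"]) simp
    then show "V_submodule ?M K \<noteq> {}" by blast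
  next
    fix a assume a: "a \<in> V_submodule ?M K"
    then obtain c where c: "a = (\<lambda>x. \<Sum>j\<in>K. pvar (V j) * c j x)" "\<forall>j\<in>K. c j \<in> carrier ?M"
      by (auto simp: V_submodule_def)
    have "(\<lambda>x. - a x) \<in> V_submodule ?M K"
      unfolding V_submodule_def
      by (rule CollectI, rule exI[of _ "\<lambda>j x. - c j x"])
        (use c in \<open>auto simp: sum_negf intro: polys_in_uminus\<close>)
    then show "\<ominus>\<^bsub>?M\<^esub> a \<in> V_submodule ?M K"
      by (simp only: free_module_uminus[OF subsetD[OF sub a]])
  next
    fix a b assume "a \<in> V_submodule ?M K" "b \<in> V_submodule ?M K"
    then obtain c d where c: "a = (\<lambda>x. \<Sum>j\<in>K. pvar (V j) * c j x)" "\<forall>j\<in>K. c j \<in> carrier ?M"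
      and d: "b = (\<lambda>x. \<Sum>j\<in>K. pvar (V j) * d j x)" "\<forall>j\<in>K. d j \<in> carrier ?M"
      by (auto simp: V_submodule_def)
    show "a \<oplus>\<^bsub>?M\<^esub> b \<in> V_submodule ?M K"
      unfolding V_submodule_def
      by (rule CollectI, rule exI[of _ "\<lambda>j x. c j x + d j x"])
        (use c d in \<open>simp add: sum.distrib distrib_left polys_in_add\<close>)
  qed
  then show ?thesis by (rule additive_subgroupI)
qed

text \<open>Two layers of cosets are unwound: the class is trivial when the coset of
  \<open>c\<close> is a boundary in the quotient, that is, equal to the coset of some
  \<open>d b\<close>.\<close>

lemma homology_class_trivial_iff:
  fixes W :: "var set" and S :: "state set"
  defines "M \<equiv> free_module W S"
  assumes "additive_subgroup I M"
    and d_in: "\<And>a. a \<in> carrier M \<Longrightarrow> d a \<in> carrier M"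
    and d_add: "\<And>a b. a \<in> carrier M \<Longrightarrow> b \<in> carrier M \<Longrightarrow> d (a \<oplus>\<^bsub>M\<^esub> b) = d a \<oplus>\<^bsub>M\<^esub> d b"
    and d_I: "d ` I \<subseteq> I"
  shows "homology_class (M A_Mod I) (induced_d M I d) (I +>\<^bsub>M\<^esub> c) =
           \<one>\<^bsub>homology (M A_Mod I) (induced_d M I d)\<^esub> \<longleftrightarrow> (\<exists>b\<in>carrier M. c \<in> I +>\<^bsub>M\<^esub> d b)"
proof -
  interpret abelian_subgroup I M
    unfolding M_def
    by (rule abelian_subgroupI3[OF assms(2)[unfolded M_def] abelian_group_free_module])
  let ?Q = "M A_Mod I" and ?d = "induced_d M I d"
  have carr: "carrier ?Q = (\<lambda>a. I +>\<^bsub>M\<^esub> a) ` carrier M"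
    by (auto simp: A_FactGroup_def FactGroup_def RCOSETS_def a_r_coset_def)
  have mult: "A \<otimes>\<^bsub>?Q\<^esub> B = A <+>\<^bsub>M\<^esub> B" for A B
    by (simp add: A_FactGroup_def FactGroup_def set_add_def)
  have d_coset: "?d (I +>\<^bsub>M\<^esub> a) = I +>\<^bsub>M\<^esub> d a" if a: "a \<in> carrier M" for a
  proof -
    \<comment> \<open>Two representatives differ by an element of \<open>I\<close>, which
      \<open>d\<close> maps into \<open>I\<close>. Hence the union defining the induced differential
      ranges over a single coset, and it is nonempty because \<open>a\<close> represents its own
      coset.\<close>
    have "I +>\<^bsub>M\<^esub> d b = I +>\<^bsub>M\<^esub> d a" if "b \<in> I +>\<^bsub>M\<^esub> a" for b
    proof -
      obtain i where i: "i \<in> I" "b = i \<oplus>\<^bsub>M\<^esub> a"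
        using \<open>b \<in> I +>\<^bsub>M\<^esub> a\<close> by (auto simp: a_r_coset_def')
      with a d_add a_Hcarr have "d b = d i \<oplus>\<^bsub>M\<^esub> d a" by blast
      with i d_I have "d b \<in> I +>\<^bsub>M\<^esub> d a" by (auto simp: a_r_coset_def')
      then show ?thesis
        using a_repr_independence[OF _ d_in[OF a] a_subgroup] by simp
    qed
    moreover have "a \<in> I +>\<^bsub>M\<^esub> a" using a by (rule a_rcos_self)
    ultimately show ?thesis unfolding induced_d_def by blast
  qed
  have group_Q: "group ?Q" by (rule a_factorgroup_is_group)
  have "?d \<in> hom ?Q ?Q"
    by (rule homI) (auto simp: carr mult d_coset a_rcos_sum d_in d_add)
  then have "group_hom ?Q ?Q ?d"
    by (simp add: group_hom_def group_hom_axioms_def group_Q)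
  then have H: "subgroup (?d ` carrier ?Q) ?Q"
    by (rule group_hom.img_is_subgroup)
  have one: "\<one>\<^bsub>homology ?Q ?d\<^esub> = ?d ` carrier ?Q"
    by (simp add: homology_def FactGroup_def)
  show ?thesis
  proof
    assume "homology_class ?Q ?d (I +>\<^bsub>M\<^esub> c) = \<one>\<^bsub>homology ?Q ?d\<^esub>"
    then have "?d ` carrier ?Q #>\<^bsub>?Q\<^esub> (I +>\<^bsub>M\<^esub> c) = ?d ` carrier ?Q"
      by (simp add: homology_class_def one)
    moreover have "I <+>\<^bsub>M\<^esub> (I +>\<^bsub>M\<^esub> c) \<in> ?d ` carrier ?Q #>\<^bsub>?Q\<^esub> (I +>\<^bsub>M\<^esub> c)"
      unfolding r_coset_def mult
      using subgroup.one_closed[OF H] by (intro UN_I[of I])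
        (simp_all add: A_FactGroup_def FactGroup_def)
    ultimately have "I <+>\<^bsub>M\<^esub> (I +>\<^bsub>M\<^esub> c) \<in> ?d ` carrier ?Q"
      by simp
    then obtain b where b: "b \<in> carrier M" "I <+>\<^bsub>M\<^esub> (I +>\<^bsub>M\<^esub> c) = I +>\<^bsub>M\<^esub> d b"
      by (auto simp: carr d_coset)
    have I_zero: "\<zero>\<^bsub>M\<^esub> \<in> I"
      by (rule additive_subgroup.zero_closed) (rule is_additive_subgroup)
    have "\<zero>\<^bsub>M\<^esub> \<oplus>\<^bsub>M\<^esub> (\<zero>\<^bsub>M\<^esub> \<oplus>\<^bsub>M\<^esub> c) \<in> I <+>\<^bsub>M\<^esub> (I +>\<^bsub>M\<^esub> c)"
      unfolding set_add_def' a_r_coset_def'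
      by (rule UN_I[OF I_zero], rule UN_I, rule UN_I[OF I_zero]) (rule singletonI)+
    \<comment> \<open>Zero and addition are pointwise, so this holds for every function
      \<open>c\<close>.\<close>
    moreover have "\<zero>\<^bsub>M\<^esub> \<oplus>\<^bsub>M\<^esub> (\<zero>\<^bsub>M\<^esub> \<oplus>\<^bsub>M\<^esub> c) = c"
      by (simp add: M_def)
    ultimately have "c \<in> I +>\<^bsub>M\<^esub> d b"
      by (simp only: b(2))
    then show "\<exists>b\<in>carrier M. c \<in> I +>\<^bsub>M\<^esub> d b"
      using b(1) by blast
  next
    assume "\<exists>b\<in>carrier M. c \<in> I +>\<^bsub>M\<^esub> d b"
    then obtain b where b: "b \<in> carrier M" "c \<in> I +>\<^bsub>M\<^esub> d b" by blast
    then have "I +>\<^bsub>M\<^esub> c = ?d (I +>\<^bsub>M\<^esub> b)"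
      using a_repr_independence[OF b(2) d_in[OF b(1)] a_subgroup] by (simp add: d_coset)
    then have "I +>\<^bsub>M\<^esub> c \<in> ?d ` carrier ?Q"
      using b(1) by (auto simp: carr)
    then have "?d ` carrier ?Q #>\<^bsub>?Q\<^esub> (I +>\<^bsub>M\<^esub> c) = ?d ` carrier ?Q"
      by (rule subgroup.rcos_const[OF H group_Q])
    then show "homology_class ?Q ?d (I +>\<^bsub>M\<^esub> c) = \<one>\<^bsub>homology ?Q ?d\<^esub>"
      by (simp add: homology_class_def one)
  qed
qed

text \<open>The linear map with matrix \<open>A\<close>, where \<open>A x y\<close> is the
  coefficient of \<open>y\<close> in the image of \<open>x\<close>. Both differentials have this
  form. The value 0 outside \<open>S\<close> keeps images in the free module.\<close>

definition matrix_map ::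
  "state set \<Rightarrow> (state \<Rightarrow> state \<Rightarrow> gpoly) \<Rightarrow> (state \<Rightarrow> gpoly) \<Rightarrow> state \<Rightarrow> gpoly" where
  "matrix_map S A c = (\<lambda>y. if y \<in> S then \<Sum>x\<in>S. c x * A x y else 0)"

lemma matrix_map_carrier:
  assumes "\<And>x y. A x y \<in> polys_in W" "c \<in> carrier (free_module W S)"
  shows "matrix_map S A c \<in> carrier (free_module W S)"
  using assms by (auto simp: matrix_map_def intro!: polys_in_sum polys_in_mult)

lemma matrix_map_add:
  "matrix_map S A (\<lambda>x. c x + c' x) = (\<lambda>y. matrix_map S A c y + matrix_map S A c' y)"
  by (auto simp: matrix_map_def fun_eq_iff sum.distrib algebra_simps)

text \<open>A matrix map is linear over the polynomials, so it commutes with multiplication by each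
  \<open>V j\<close>; formally, two finite sums are exchanged.\<close>

lemma matrix_map_V_submodule:
  assumes "\<And>x y. A x y \<in> polys_in W"
  shows "matrix_map S A ` V_submodule (free_module W S) K \<subseteq> V_submodule (free_module W S) K"
proof
  fix b assume "b \<in> matrix_map S A ` V_submodule (free_module W S) K"
  then obtain c where c: "\<forall>j\<in>K. c j \<in> carrier (free_module W S)"
    and b: "b = matrix_map S A (\<lambda>x. \<Sum>j\<in>K. pvar (V j) * c j x)"
    by (auto simp: V_submodule_def)
  have "b = (\<lambda>x. \<Sum>j\<in>K. pvar (V j) * matrix_map S A (c j) x)"
  proof
    fix y
    have "(\<Sum>x\<in>S. (\<Sum>j\<in>K. pvar (V j) * c j x) * A x y) =
        (\<Sum>x\<in>S. \<Sum>j\<in>K. pvar (V j) * (c j x * A x y))"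
      by (simp add: sum_distrib_right mult.assoc)
    also have "\<dots> = (\<Sum>j\<in>K. pvar (V j) * (\<Sum>x\<in>S. c j x * A x y))"
      unfolding sum_distrib_left by (rule sum.swap)
    finally show "b y = (\<Sum>j\<in>K. pvar (V j) * matrix_map S A (c j) y)"
      by (simp add: b matrix_map_def)
  qed
  moreover have "\<forall>j\<in>K. matrix_map S A (c j) \<in> carrier (free_module W S)"
    by (intro ballI matrix_map_carrier assms bspec[OF c])
  ultimately show "b \<in> V_submodule (free_module W S) K"
    unfolding V_submodule_def
    by (intro CollectI exI[of _ "\<lambda>j. matrix_map S A (c j)"]) simp
qed

text \<open>Linearity supplies what the general criterion asks of a differential. Vanishing thus
  becomes one equation in the free module, modulo the submodule, in a form that fits both
  complexes.\<close>

lemma matrix_map_homology_class_trivial_iff: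
  fixes W S K A
  defines "M \<equiv> free_module W S"
  defines "I \<equiv> V_submodule M K"
  defines "d \<equiv> induced_d M I (matrix_map S A)"
  assumes "V ` K \<subseteq> W" and "\<And>x y. A x y \<in> polys_in W"
  shows "homology_class (M A_Mod I) d (I +>\<^bsub>M\<^esub> c) = \<one>\<^bsub>homology (M A_Mod I) d\<^esub> \<longleftrightarrow>
           (\<exists>b\<in>carrier M. c \<in> I +>\<^bsub>M\<^esub> matrix_map S A b)"
  unfolding M_def I_def d_def
  by (rule homology_class_trivial_iff)
    (simp_all only: additive_subgroup_V_submodule assms matrix_map_carrier matrix_map_V_submodule
      free_module_simps(3) matrix_map_add)

text \<open>The substitution is multiplicative and fixes every \<open>V j\<close>, so it acts on the
  coefficients of a combination and descends to the quotients.\<close>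

lemma set_v_zero_V_submodule:
  assumes "i \<in> V_submodule (free_module (insert v W) S) K"
  shows "(\<lambda>x. set_v_zero (i x)) \<in> V_submodule (free_module W S) K"
proof -
  obtain c where c: "\<forall>j\<in>K. c j \<in> carrier (free_module (insert v W) S)"
    and i: "i = (\<lambda>x. \<Sum>j\<in>K. pvar (V j) * c j x)"
    using assms by (auto simp: V_submodule_def)
  have "set_v_zero (pvar (V j)) = pvar (V j)" for j
    by (rule set_v_zero_id[of _ "{V j}"]) (simp_all add: polys_in_pvar)
  with i have "(\<lambda>x. set_v_zero (i x)) = (\<lambda>x. \<Sum>j\<in>K. pvar (V j) * set_v_zero (c j x))"
    by (simp add: set_v_zero_sum set_v_zero_mult)
  with c show ?thesis
    unfolding V_submodule_def
    by (intro CollectI exI[of _ "\<lambda>j x. set_v_zero (c j x)"]) (auto intro: set_v_zero_in)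
qed

text \<open>This makes the substitution a chain map as soon as it carries the entries of one
  differential to those of the other.\<close>

lemma set_v_zero_matrix_map:
  "set_v_zero (matrix_map S A c y) =
     matrix_map S (\<lambda>x y. set_v_zero (A x y)) (\<lambda>x. set_v_zero (c x)) y"
  by (simp add: matrix_map_def set_v_zero_sum set_v_zero_mult)

section \<open>Comparison of the two grid complexes\<close>

definition minus_coeff :: "grid \<Rightarrow> state \<Rightarrow> state \<Rightarrow> gpoly" where
  "minus_coeff G x y = (\<Sum>r | r \<in> empty_Rect G x y \<and> avoids_X G r. V_weight G r)"

definition big_coeff :: "grid \<Rightarrow> state \<Rightarrow> state \<Rightarrow> gpoly" where
  "big_coeff G x y = (\<Sum>r | r \<in> Rect G x y \<and> avoids_X G r.
     V_weight G r * pvar v ^ card (rect_interior (gsize G) r \<inter> x))"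

lemma d_minus_eq_matrix_map: "d_minus G = matrix_map (grid_states G) (minus_coeff G)"
  by (simp add: fun_eq_iff d_minus_def matrix_map_def minus_coeff_def)

lemma d_big_eq_matrix_map: "d_big G = matrix_map (grid_states G) (big_coeff G)"
  by (simp add: fun_eq_iff d_big_def matrix_map_def big_coeff_def)

lemma V_weight_in: "V_weight G r \<in> polys_in (V ` {1..gsize G})"
  unfolding V_weight_def by (intro polys_in_prod polys_in_power polys_in_pvar) auto

lemma minus_coeff_in: "minus_coeff G x y \<in> polys_in (V ` {1..gsize G})"
  unfolding minus_coeff_def by (intro polys_in_sum V_weight_in)

lemma big_coeff_in: "big_coeff G x y \<in> polys_in (insert v (V ` {1..gsize G}))"
  unfolding big_coeff_def
  by (intro polys_in_sum polys_in_mult polys_in_power polys_in_pvar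
      subsetD[OF polys_in_mono V_weight_in]) auto

section \<open>Rectangles on the torus and their interiors\<close>

lemma finite_rectangles: "finite (rectangles n)"
proof (rule finite_subset)
  show "rectangles n \<subseteq> (\<lambda>(a, b, c, d). \<lparr>rleft = a, rbottom = b, rwidth = c, rheight = d\<rparr>) `
          ({..<n} \<times> {..<n} \<times> {1..<n} \<times> {1..<n})"
  proof
    fix r assume r: "r \<in> rectangles n"
    show "r \<in> (\<lambda>(a, b, c, d). \<lparr>rleft = a, rbottom = b, rwidth = c, rheight = d\<rparr>) `
          ({..<n} \<times> {..<n} \<times> {1..<n} \<times> {1..<n})"
      by (rule image_eqI[of _ _ "(rleft r, rbottom r, rwidth r, rheight r)"])
        (use r in \<open>auto simp: rectangles_def\<close>)
  qed
qed simp

lemma finite_Rect: "finite (Rect G x y)"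
  by (rule finite_subset[OF _ finite_rectangles[of "gsize G"]]) (auto simp: Rect_def)

lemma add_mod_ne_self:
  fixes a c n :: nat
  assumes "0 < c" "c < n"
  shows "(a + c) mod n \<noteq> a mod n"
proof
  assume "(a + c) mod n = a mod n"
  then have "n dvd (a + c) - a" by (subst (asm) mod_eq_dvd_iff_nat) auto
  with assms show False by (auto dest: dvd_imp_le)
qed

text \<open>Interior points have both offsets strictly between 0 and \<open>n\<close>, so they avoid
  the circles through the bottom and left edges. The choices \<open>w = rwidth r\<close> and
  \<open>h = rheight r\<close> give the SE and NW vertices.\<close>

lemma corner_notin_interior:
  assumes "r \<in> rectangles n"
  shows "rect_pt n r w 0 \<notin> rect_interior n r" "rect_pt n r 0 h \<notin> rect_interior n r"
proof -
  have less: "rwidth r < n" "rheight r < n"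
    using assms by (auto simp: rectangles_def)
  show "rect_pt n r w 0 \<notin> rect_interior n r"
  proof
    assume "rect_pt n r w 0 \<in> rect_interior n r"
    then obtain d where d: "0 < d" "d < rheight r" "(rbottom r + d) mod n = rbottom r mod n"
      by (auto simp: rect_interior_def rect_pt_def)
    with less add_mod_ne_self[of d n "rbottom r"] show False by simp
  qed
  show "rect_pt n r 0 h \<notin> rect_interior n r"
  proof
    assume "rect_pt n r 0 h \<in> rect_interior n r"
    then obtain c where c: "0 < c" "c < rwidth r" "(rleft r + c) mod n = rleft r mod n"
      by (auto simp: rect_interior_def rect_pt_def)
    with less add_mod_ne_self[of c n "rleft r"] show False by simp
  qed
qed

text \<open>The points of \<open>y\<close> outside \<open>x\<close> are the SE and NW vertices,
  which are never interior. Counting interior points of \<open>x\<close>, as the exponent of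
  \<open>v\<close> does, therefore detects emptiness.\<close>

lemma empty_Rect_iff:
  "r \<in> empty_Rect G x y \<longleftrightarrow> r \<in> Rect G x y \<and> rect_interior (gsize G) r \<inter> x = {}"
proof -
  have "rect_interior (gsize G) r \<inter> y = {}"
    if r: "r \<in> Rect G x y" and x: "rect_interior (gsize G) r \<inter> x = {}"
  proof -
    have "r \<in> rectangles (gsize G)"
      and "y - x = {rect_pt (gsize G) r (rwidth r) 0, rect_pt (gsize G) r 0 (rheight r)}"
      using r by (auto simp: Rect_def)
    with corner_notin_interior have "rect_interior (gsize G) r \<inter> (y - x) = {}" by auto
    with x show ?thesis by blast
  qed
  then show ?thesis by (auto simp: empty_Rect_def)
qed

lemma finite_rect_interior: "finite (rect_interior n r)"
  by (rule finite_subset[of _ "(\<lambda>(c, d). rect_pt n r c d) ` ({..<rwidth r} \<times> {..<rheight r})"])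
    (auto simp: rect_interior_def)

text \<open>After the substitution a rectangle carries a power of 0, which is 1 for exponent 0 and
  vanishes otherwise. As interiors are finite, exponent 0 means that no point of \<open>x\<close> is
  interior, so exactly the empty rectangles survive, with their \<open>V_weight\<close>
  unchanged.\<close>

lemma set_v_zero_big_coeff: "set_v_zero (big_coeff G x y) = minus_coeff G x y"
proof -
  let ?int = "\<lambda>r. rect_interior (gsize G) r \<inter> x"
  have V: "set_v_zero (V_weight G r) = V_weight G r" for r
    by (rule set_v_zero_id[OF V_weight_in]) auto
  have "set_v_zero (big_coeff G x y) =
      (\<Sum>r | r \<in> Rect G x y \<and> avoids_X G r. if ?int r = {} then V_weight G r else 0)"
    unfolding big_coeff_def set_v_zero_sum
    by (rule sum.cong)
      (auto simp: set_v_zero_mult set_v_zero_power V power_0_left finite_rect_interior)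
  also have "\<dots> = (\<Sum>r | (r \<in> Rect G x y \<and> avoids_X G r) \<and> ?int r = {}. V_weight G r)"
    using finite_Rect[of G x y] by (simp add: sum.If_cases Int_def)
  also have "\<dots> = minus_coeff G x y"
    unfolding minus_coeff_def by (rule sum.cong) (auto simp: empty_Rect_iff)
  finally show ?thesis .
qed

section \<open>Basepoints index variables of the complexes\<close>

lemma next_O_in:
  assumes "grid_diagram G" "i \<in> {1..gsize G}"
  shows "next_O G i \<in> {1..gsize G}"
proof -
  have X: "one_per_row_and_column (gsize G) (Xmark G)"
    and O: "one_per_row_and_column (gsize G) (Omark G)"
    using assms(1) by (auto simp: grid_diagram_def)
  have "snd (Omark G i) < gsize G"
    using O assms(2) by (auto simp: one_per_row_and_column_def mem_Times_iff)
  with X have "\<exists>!m. m \<in> {1..gsize G} \<and> snd (Xmark G m) = snd (Omark G i)"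
    by (simp add: one_per_row_and_column_def)
  \<comment> \<open>Uniqueness of the marking in its row makes the definite description denote an
    actual index; the same is done below for the column.\<close>
  from theI'[OF this] have "X_in_row_of G i \<in> {1..gsize G}"
    by (simp add: X_in_row_of_def)
  with X have "fst (Xmark G (X_in_row_of G i)) < gsize G"
    by (auto simp: one_per_row_and_column_def mem_Times_iff)
  with O have "\<exists>!j. j \<in> {1..gsize G} \<and> fst (Omark G j) = fst (Xmark G (X_in_row_of G i))"
    by (simp add: one_per_row_and_column_def)
  from theI'[OF this] show ?thesis
    by (simp add: next_O_def O_in_column_of_def)
qed

text \<open>Components are forward orbits of \<open>next_O\<close>, which preserves the index range.
  Hence the variables divided out belong to both polynomial rings.\<close>

lemma basepoints_subset:
  assumes "grid_diagram G" "component_choice G k"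
  shows "basepoints G k \<subseteq> {1..gsize G}"
proof -
  have "(next_O G ^^ m) i \<in> {1..gsize G}" if "i \<in> {1..gsize G}" for m i
    by (induction m) (use that next_O_in[OF assms(1)] in auto)
  then have "C \<subseteq> {1..gsize G}" if "C \<in> link_components G" for C
    using that unfolding link_components_def link_component_def by auto
  with assms(2) show ?thesis
    by (auto simp: basepoints_def component_choice_def)
qed

lemma hat_class_trivial_if_big:
  assumes "grid_diagram G" "component_choice G k"
    and big: "hat_big_class G k x = \<one>\<^bsub>GH_hat_big G k\<^esub>"
  shows "hat_class G k x = \<one>\<^bsub>GH_hat G k\<^esub>"
proof -
  let ?W = "V ` {1..gsize G}" and ?S = "grid_states G" and ?K = "basepoints G k"
  let ?M = "free_module ?W ?S" and ?B = "free_module (insert v ?W) ?S"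
  let ?\<phi> = "\<lambda>c x. set_v_zero (c x)"
  have K: "V ` ?K \<subseteq> ?W" and KB: "V ` ?K \<subseteq> insert v ?W"
    using basepoints_subset[OF assms(1,2)] by auto
  \<comment> \<open>The criterion turns the vanishing class into a chain \<open>b\<close> whose
    boundary is the generator modulo the submodule.\<close>
  obtain b where b: "b \<in> carrier ?B"
    and "generator x \<in> V_submodule ?B ?K +>\<^bsub>?B\<^esub> matrix_map ?S (big_coeff G) b"
    using big[unfolded hat_big_class_def GH_hat_big_def GC_hat_big_def d_hat_big_def GC_big_def
      d_big_eq_matrix_map matrix_map_homology_class_trivial_iff[OF KB big_coeff_in]]
    by (rule bexE)
  then obtain i where i: "i \<in> V_submodule ?B ?K"
    and gen: "generator x = (\<lambda>y. i y + matrix_map ?S (big_coeff G) b y)"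
    by (auto simp: a_r_coset_def')
  \<comment> \<open>The substitution is applied to \<open>gen\<close> at each state: the
    coefficients 0 and 1 of the generator are fixed, and the big matrix becomes that of
    \<open>d_minus\<close>.\<close>
  have "generator x y = ?\<phi> i y + matrix_map ?S (minus_coeff G) (?\<phi> b) y" for y
  proof -
    have "generator x y = set_v_zero (generator x y)" by (simp add: generator_def)
    then show ?thesis
      by (simp add: gen set_v_zero_add set_v_zero_matrix_map set_v_zero_big_coeff)
  qed
  then have "generator x \<in> V_submodule ?M ?K +>\<^bsub>?M\<^esub> matrix_map ?S (minus_coeff G) (?\<phi> b)"
    unfolding a_r_coset_def'
    by (intro UN_I[OF set_v_zero_V_submodule[OF i]]) (auto simp: fun_eq_iff)
  moreover have "?\<phi> b \<in> carrier ?M"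
    using b by (auto intro: set_v_zero_in)
  ultimately show ?thesis
    unfolding hat_class_def GH_hat_def GC_hat_def d_hat_def GC_minus_def
      d_minus_eq_matrix_map matrix_map_homology_class_trivial_iff[OF K minus_coeff_in]
    by (rule bexI)
qed

theorem theorem1p10:
  fixes \<Lambda> :: "(real \<Rightarrow> R3) set" and G :: grid and k :: "nat set \<Rightarrow> nat"
  assumes "legendrian_link \<Lambda>"
    and "grid_diagram G"
    and "represents G \<Lambda>"
    and "component_choice G k"
  shows "(lambda_hat_big_plus G k = \<one>\<^bsub>GH_hat_big G k\<^esub> \<longrightarrow> lambda_hat_plus G k = \<one>\<^bsub>GH_hat G k\<^esub>) \<and>
         (lambda_hat_big_minus G k = \<one>\<^bsub>GH_hat_big G k\<^esub> \<longrightarrow> lambda_hat_minus G k = \<one>\<^bsub>GH_hat G k\<^esub>)"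
  \<comment> \<open>The comparison holds for an arbitrary state; the two implications are its
    instances at \<open>x_plus G\<close> and \<open>x_minus G\<close>.\<close>
  using hat_class_trivial_if_big[OF assms(2,4)]
  by (simp add: lambda_hat_plus_def lambda_hat_minus_def lambda_hat_big_plus_def
      lambda_hat_big_minus_def)

end
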